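(* For every positive integer $k$ and every real number $x>0$, $$\frac{P_{2k}(x)}{Q_{2k}(x)}<F(x)<\frac{P_{2k-1}(x)}{Q_{2k-1}(x)}.$$
   Context: For real $x>0$ put $F(x)=e^{x}\int_x^\infty \frac{e^{-t}}{t}\,dt=\int_0^\infty \frac{e^{-t}}{t+x}\,dt$. For an integer $m\ge1$ let $c_m=c_m(x)$ be $x$ if $m$ is odd and $\frac{2}{m}$ if $m$ is even. The polynomials $P_n(x),Q_n(x)$ are defined by $P_{-1}(x)=1$, $Q_{-1}(x)=0$, $P_0(x)=0$, $Q_0(x)=1$, and, for $n\ge1$, $P_n(x)=c_nP_{n-1}(x)+P_{n-2}(x)$, $Q_n(x)=c_nQ_{n-1}(x)+Q_{n-2}(x)$. *)

theory Defs
  imports "HOL-Analysis.Analysis" "HOL-Computational_Algebra.Polynomial"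
begin

definition F :: "real \<Rightarrow> real" where
  "F x = exp x * integral {x..} (\<lambda>t. exp (- t) / t)"

definition c :: "int \<Rightarrow> real poly" where
  "c m = (if odd m then [:0, 1:] else [:2 / real_of_int m:])"

(* The index type is int because the recursion starts at -1; values at indices
   below -1 are irrelevant. *)
function P :: "int \<Rightarrow> real poly" where
  "P n = (if n \<le> -1 then 1 else if n = 0 then 0
          else c n * P (n - 1) + P (n - 2))"
  by auto
termination by (relation "Wellfounded.measure (\<lambda>n. nat (n + 2))") auto

function Q :: "int \<Rightarrow> real poly" where
  "Q n = (if n \<le> -1 then 0 else if n = 0 then 1
          else c n * Q (n - 1) + Q (n - 2))"
  by auto
termination by (relation "Wellfounded.measure (\<lambda>n. nat (n + 2))") auto

declare P.simps [simp del] Q.simps [simp del]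

lemma P_rec:
  "P (- 1) = 1" "P 0 = 0" "n \<ge> 1 \<Longrightarrow> P n = c n * P (n - 1) + P (n - 2)"
  by (subst P.simps, simp)+

lemma Q_rec:
  "Q (- 1) = 0" "Q 0 = 1" "n \<ge> 1 \<Longrightarrow> Q n = c n * Q (n - 1) + Q (n - 2)"
  by (subst Q.simps, simp)+

end

theory Submission
  imports Defs
begin

text \<open>Put \<open>w = (t - x) / t\<close>, and let \<open>A n\<close> and \<open>B n\<close> be the integrals of
  \<open>exp (x - t) * w ^ n / t\<close> and \<open>exp (x - t) * w ^ n\<close> over \<open>t \<ge> x\<close>; thus \<open>A 0 = F x\<close> and
  \<open>B 0 = 1\<close>. Since \<open>w = 1 - x / t\<close>, we have \<open>B (n + 1) = B n - x * A n\<close>, and integration by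
  parts gives \<open>A n = A (n - 1) - B n / n\<close>. These are the recurrences of the continued fraction,
  so \<open>Q F - P\<close> equals \<open>A n\<close> at index \<open>2 n\<close> and \<open>- B n\<close> at index \<open>2 n - 1\<close>; both integrals
  are positive.\<close>

text \<open>The constant factor \<open>exp x\<close> stays outside the integrals, as in
  \<open>F\<close>, so that \<open>exp (- t)\<close> itself is a majorant.\<close>

definition expw :: "real \<Rightarrow> nat \<Rightarrow> real \<Rightarrow> real" where
  "expw x n t = exp (- t) * ((t - x) / t) ^ n"

definition intA :: "real \<Rightarrow> nat \<Rightarrow> real" where
  "intA x n = exp x * integral {x..} (\<lambda>t. expw x n t / t)"

definition intB :: "real \<Rightarrow> nat \<Rightarrow> real" where
  "intB x n = exp x * integral {x..} (expw x n)"

lemma intA_0: "intA x 0 = F x"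
  by (simp add: intA_def F_def expw_def)

context
  fixes x :: real
  assumes x: "x > 0"
begin

lemma expw_bounds:
  assumes "t \<ge> x"
  shows "0 \<le> expw x n t" "expw x n t \<le> exp (- t)"
  using assms x by (auto simp: expw_def power_le_one)

lemma has_integral_exp: "((\<lambda>t. exp (- t)) has_integral exp (- x)) {x..}"
  using has_integral_exp_minus_to_infinity[of 1 x] by simp

lemma continuous_on_expw: "continuous_on {x..} (expw x n)"
  unfolding expw_def using x by (intro continuous_intros) auto

lemma continuous_on_expw_div: "continuous_on {x..} (\<lambda>t. expw x n t / t)"
  using x by (intro continuous_intros continuous_on_expw) auto

lemma expw_integrable: "expw x n integrable_on {x..}"
proof (rule measurable_bounded_by_integrable_imp_integrable_real)
  show "(\<lambda>t. exp (- t)) integrable_on {x..}"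
    using has_integral_exp by blast
qed (use expw_bounds in \<open>auto intro!: continuous_imp_measurable_on_sets_lebesgue continuous_on_expw\<close>)

lemma expw_div_integrable: "(\<lambda>t. expw x n t / t) integrable_on {x..}"
proof (rule measurable_bounded_by_integrable_imp_integrable_real)
  \<comment> \<open>On the ray, 1/t is at most 1/x, which gives this majorant.\<close>
  show "(\<lambda>t. exp (- t) / x) integrable_on {x..}"
    using has_integral_exp by (intro integrable_on_divide) blast
  show "\<bar>expw x n t / t\<bar> \<le> exp (- t) / x" if "t \<in> {x..}" for t
    using that expw_bounds[of t n] x by (auto intro!: frac_le)
qed (auto intro!: continuous_imp_measurable_on_sets_lebesgue continuous_on_expw_div)

lemma intA_nonneg: "0 \<le> intA x n"
  unfolding intA_def using x expw_bounds
  by (intro mult_nonneg_nonneg integral_nonneg expw_div_integrable) auto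

lemma intB_nonneg: "0 \<le> intB x n"
  unfolding intB_def using expw_bounds
  by (intro mult_nonneg_nonneg integral_nonneg expw_integrable) auto

lemma intB_0: "intB x 0 = 1"
proof -
  have "expw x 0 = (\<lambda>t. exp (- t))" by (simp add: expw_def fun_eq_iff)
  then show ?thesis
    using integral_unique[OF has_integral_exp] by (simp add: intB_def exp_minus)
qed

lemma intB_Suc: "intB x (Suc n) = intB x n - x * intA x n"
proof -
  have "integral {x..} (expw x (Suc n)) =
      integral {x..} (\<lambda>t. expw x n t - x * (expw x n t / t))"
    using x by (intro integral_cong) (auto simp: expw_def field_simps)
  also have "\<dots> = integral {x..} (expw x n) - x * integral {x..} (\<lambda>t. expw x n t / t)"
    using expw_integrable expw_div_integrable
    by (simp add: integral_diff integrable_on_mult_right del: times_divide_eq_right)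
  finally show ?thesis
    by (simp add: intA_def intB_def right_diff_distrib mult.left_commute)
qed

text \<open>Adding \<open>exp (- t)\<close> to the derivative of \<open>exp (- t) * w ^ Suc n\<close> makes it nonnegative, so
  that integrating up to infinity needs only monotone convergence.\<close>

lemma intB_eq_intA_diff: "intB x (Suc n) = Suc n * (intA x n - intA x (Suc n))"
proof -
  \<comment> \<open>\<open>h\<close> is the derivative of \<open>G\<close>: the product rule gives
    the first summand and \<open>- expw x (Suc n) t\<close>; the term \<open>exp (- t)\<close> comes
    from the correction in \<open>G\<close>.\<close>
  define h where "h t = Suc n * (expw x n t / t - expw x (Suc n) t / t)
      + (exp (- t) - expw x (Suc n) t)" for t
  define G where "G t = expw x (Suc n) t - exp (- t)" for t
  have h_nonneg: "h t \<ge> 0" if "t \<ge> x" for t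
  proof -
    have "((t - x) / t) * ((t - x) / t) ^ n \<le> ((t - x) / t) ^ n"
      using that x by (intro mult_left_le_one_le) auto
    then have "expw x (Suc n) t \<le> expw x n t"
      unfolding expw_def power_Suc by (intro mult_left_mono) auto
    then have "expw x n t / t - expw x (Suc n) t / t \<ge> 0"
      using that x by (simp add: divide_right_mono)
    with expw_bounds(2)[OF that, of "Suc n"] show ?thesis
      unfolding h_def by (intro add_nonneg_nonneg mult_nonneg_nonneg) auto
  qed
  have deriv: "(G has_real_derivative h t) (at t within S)" if "t \<ge> x" for t S
  proof -
    have "t > 0" using that x by simp
    \<comment> \<open>Writing w' as (1 - w) / t instead of x / t^2 makes w^n * w' a difference of
      two consecutive integrands of \<open>intA\<close>.\<close>
    then have w: "((\<lambda>t. (t - x) / t) has_real_derivative (1 - (t - x) / t) / t) (at t within S)"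
      by (auto intro!: derivative_eq_intros simp: field_simps)
    have e: "((\<lambda>t::real. exp (- t)) has_real_derivative - exp (- t)) (at t within S)"
      by (auto intro!: derivative_eq_intros)
    show ?thesis
      unfolding G_def h_def expw_def
      by (rule DERIV_cong[OF DERIV_diff[OF DERIV_mult[OF e DERIV_power[OF w]] e]])
        (simp add: algebra_simps add_divide_distrib diff_divide_distrib)
  qed
  have int_h: "(h has_integral (G y - G x)) {x..y}" if "y \<ge> x" for y
    using that deriv by (intro fundamental_theorem_of_calculus)
      (auto simp flip: has_real_derivative_iff_has_vector_derivative)
  \<comment> \<open>The value is the limit 0 of \<open>G\<close> minus \<open>G x\<close>; here
    \<open>G x = - exp (- x)\<close>, because w vanishes at x and the exponent \<open>Suc n\<close>
    is positive.\<close>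
  have "(h has_integral exp (- x)) {x..}"
  proof (rule has_integral_to_inf)
    show "h integrable_on {x..y}" for y
      using int_h[of y] by (cases "x \<le> y") auto
    have lim_exp: "((\<lambda>y::real. exp (- y)) \<longlongrightarrow> 0) at_top"
      by (intro filterlim_compose[OF exp_at_bot] filterlim_uminus_at_bot_at_top)
    have "(expw x (Suc n) \<longlongrightarrow> 0) at_top"
      by (rule tendsto_sandwich[OF _ _ tendsto_const lim_exp])
        (use expw_bounds in \<open>auto intro!: eventually_mono[OF eventually_ge_at_top[of x]]\<close>)
    then have "((\<lambda>y. G y - G x) \<longlongrightarrow> 0 - 0 - G x) at_top"
      unfolding G_def using lim_exp by (intro tendsto_intros)
    moreover have "\<forall>\<^sub>F y in at_top. G y - G x = integral {x..y} h"
      using eventually_ge_at_top[of x] by eventually_elim (simp add: integral_unique[OF int_h])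
    ultimately show "((\<lambda>y. integral {x..y} h) \<longlongrightarrow> exp (- x)) at_top"
      using x by (auto intro: Lim_transform_eventually simp: G_def expw_def)
  qed (use h_nonneg in auto)
  \<comment> \<open>Integrating \<open>h\<close> term by term gives a second value; comparing the
    two cancels the correction \<open>exp (- x)\<close>.\<close>
  moreover have "(h has_integral Suc n * (integral {x..} (\<lambda>t. expw x n t / t) -
      integral {x..} (\<lambda>t. expw x (Suc n) t / t)) +
      (exp (- x) - integral {x..} (expw x (Suc n)))) {x..}"
    unfolding h_def
    by (intro has_integral_add has_integral_diff has_integral_mult_right has_integral_exp
        integrable_integral expw_integrable expw_div_integrable)
  ultimately have "exp (- x) = Suc n * (integral {x..} (\<lambda>t. expw x n t / t) -
      integral {x..} (\<lambda>t. expw x (Suc n) t / t)) +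
      (exp (- x) - integral {x..} (expw x (Suc n)))"
    by (rule has_integral_unique)
  then have "integral {x..} (expw x (Suc n)) = Suc n * (integral {x..} (\<lambda>t. expw x n t / t) -
      integral {x..} (\<lambda>t. expw x (Suc n) t / t))"
    by linarith
  then show ?thesis
    by (simp only: intA_def intB_def right_diff_distrib mult.left_commute)
qed

text \<open>By the recurrences, a vanishing integral would force an earlier one to vanish or a later
  one to be negative.\<close>

lemma intA_pos_if_intB_pos:
  assumes "intB x n > 0"
  shows "intA x n > 0"
proof (rule ccontr)
  assume "\<not> intA x n > 0"
  then have A: "intA x n = 0" using intA_nonneg[of n] by simp
  then have "intB x (Suc n) > 0" using assms by (simp add: intB_Suc)
  moreover have "intB x (Suc n) \<le> 0"
    unfolding intB_eq_intA_diff using A intA_nonneg[of "Suc n"] by (simp add: mult_nonneg_nonpos)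
  ultimately show False by simp
qed

lemma intB_pos: "intB x n > 0"
proof (induction n)
  case 0
  show ?case by (simp add: intB_0)
next
  case (Suc n)
  have A: "intA x n > 0"
    by (rule intA_pos_if_intB_pos[OF Suc])
  show ?case
  proof (rule ccontr)
    assume "\<not> intB x (Suc n) > 0"
    then have B: "intB x (Suc n) = 0" using intB_nonneg[of "Suc n"] by simp
    then have "intA x (Suc n) = intA x n" using intB_eq_intA_diff[of n] by simp
    then have "x * intA x (Suc n) > 0" using A x by simp
    \<comment> \<open>The next integral \<open>intB x (Suc (Suc n))\<close> would be
      \<open>- x * intA x (Suc n)\<close>, hence negative.\<close>
    then show False using intB_Suc[of "Suc n"] B intB_nonneg[of "Suc (Suc n)"] by linarith
  qed
qed

lemma intA_pos: "intA x n > 0"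
  by (intro intA_pos_if_intB_pos intB_pos)

lemma poly_c_odd: "poly (c (2 * int n + 1)) x = x"
  by (simp add: c_def)

lemma poly_c_even: "poly (c (2 * int n + 2)) x = 1 / Suc n"
  by (simp add: c_def field_simps)

lemma poly_rec:
  "poly (P (2 * int n + 1)) x = x * poly (P (2 * int n)) x + poly (P (2 * int n - 1)) x"
  "poly (Q (2 * int n + 1)) x = x * poly (Q (2 * int n)) x + poly (Q (2 * int n - 1)) x"
  "poly (P (2 * int n + 2)) x = poly (P (2 * int n + 1)) x / Suc n + poly (P (2 * int n)) x"
  "poly (Q (2 * int n + 2)) x = poly (Q (2 * int n + 1)) x / Suc n + poly (Q (2 * int n)) x"
proof -
  have shift: "2 * int n + 1 - 1 = 2 * int n" "2 * int n + 1 - 2 = 2 * int n - 1"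
    "2 * int n + 2 - 1 = 2 * int n + 1" "2 * int n + 2 - 2 = 2 * int n"
    by simp_all
  note rec = P_rec(3)[of "2 * int n + 1", unfolded shift] Q_rec(3)[of "2 * int n + 1", unfolded shift]
    P_rec(3)[of "2 * int n + 2", unfolded shift] Q_rec(3)[of "2 * int n + 2", unfolded shift]
  show
    "poly (P (2 * int n + 1)) x = x * poly (P (2 * int n)) x + poly (P (2 * int n - 1)) x"
    "poly (Q (2 * int n + 1)) x = x * poly (Q (2 * int n)) x + poly (Q (2 * int n - 1)) x"
    "poly (P (2 * int n + 2)) x = poly (P (2 * int n + 1)) x / Suc n + poly (P (2 * int n)) x"
    "poly (Q (2 * int n + 2)) x = poly (Q (2 * int n + 1)) x / Suc n + poly (Q (2 * int n)) x"
    by (subst rec; simp add: poly_c_odd poly_c_even)+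
qed

text \<open>Both parities go through one induction. At odd indices only a weak inequality can be
  claimed, since \<open>Q (- 1) = 0\<close> at n = 0.\<close>

lemma poly_Q_odd_nonneg_even_pos:
  "poly (Q (2 * int n - 1)) x \<ge> 0 \<and> poly (Q (2 * int n)) x > 0"
proof (induction n)
  case 0
  show ?case by (simp add: Q_rec)
next
  case (Suc n)
  have "poly (Q (2 * int n + 1)) x > 0"
    using Suc x by (simp add: poly_rec add_pos_nonneg)
  then have "poly (Q (2 * int n + 2)) x > 0"
    using Suc by (simp add: poly_rec(4) add_pos_pos)
  with \<open>poly (Q (2 * int n + 1)) x > 0\<close> show ?case
    by (simp add: algebra_simps)
qed

lemma poly_Q_even_pos: "poly (Q (2 * int n)) x > 0"
  using poly_Q_odd_nonneg_even_pos by blast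

lemma poly_Q_odd_pos: "poly (Q (2 * int n + 1)) x > 0"
  using poly_Q_odd_nonneg_even_pos[of n] x by (simp add: poly_rec add_pos_nonneg)

text \<open>By linearity Q F - P inherits the recurrence of P and Q. Flipping its sign at odd
  indices turns the sums of \<open>poly_rec\<close> into the differences of \<open>intB_Suc\<close>
  and \<open>intB_eq_intA_diff\<close>.\<close>

lemma remainder:
  "poly (Q (2 * int n)) x * F x - poly (P (2 * int n)) x = intA x n \<and>
   poly (P (2 * int n - 1)) x - poly (Q (2 * int n - 1)) x * F x = intB x n"
proof (induction n)
  case 0
  show ?case by (simp add: P_rec Q_rec intA_0 intB_0)
next
  case (Suc n)
  have odd: "poly (P (2 * int n + 1)) x - poly (Q (2 * int n + 1)) x * F x = intB x (Suc n)"
    unfolding intB_Suc poly_rec Suc[THEN conjunct1, symmetric] Suc[THEN conjunct2, symmetric]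
    by (simp add: algebra_simps)
  have "poly (Q (2 * int n + 2)) x * F x - poly (P (2 * int n + 2)) x =
      intA x n - intB x (Suc n) / Suc n"
    unfolding poly_rec(3,4) odd[symmetric] Suc[THEN conjunct1, symmetric]
    by (simp add: diff_divide_distrib algebra_simps del: of_nat_Suc)
  also have "\<dots> = intA x (Suc n)"
    by (simp add: intB_eq_intA_diff del: of_nat_Suc)
  finally show ?case using odd by (simp add: algebra_simps)
qed

end

theorem theorem5p2:
  fixes k :: int and x :: real
  assumes "k > 0" and "x > 0"
  shows "poly (P (2 * k)) x / poly (Q (2 * k)) x < F x
       \<and> F x < poly (P (2 * k - 1)) x / poly (Q (2 * k - 1)) x"
proof -
  \<comment> \<open>The odd index 2k - 1 is 2n + 1, so \<open>poly_Q_odd_pos\<close> is used at n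
    but \<open>remainder\<close> at \<open>Suc n\<close>.\<close>
  obtain n where n: "k = int (Suc n)"
    using \<open>k > 0\<close> by (metis gr0_implies_Suc zero_less_imp_eq_int)
  have "poly (Q (2 * k)) x > 0"
    using poly_Q_even_pos[OF \<open>x > 0\<close>] n by blast
  moreover have "poly (Q (2 * k - 1)) x > 0"
    using poly_Q_odd_pos[OF \<open>x > 0\<close>, of n] n by (simp add: algebra_simps)
  moreover have "poly (Q (2 * k)) x * F x - poly (P (2 * k)) x > 0"
    using remainder[OF \<open>x > 0\<close>, of "Suc n"] intA_pos[OF \<open>x > 0\<close>, of "Suc n"] n by simp
  moreover have "poly (P (2 * k - 1)) x - poly (Q (2 * k - 1)) x * F x > 0"
    using remainder[OF \<open>x > 0\<close>, of "Suc n"] intB_pos[OF \<open>x > 0\<close>, of "Suc n"] n by simp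
  ultimately show ?thesis
    by (simp add: divide_simps mult.commute)
qed

end
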